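(* Let $F$ be an idempotent $u$-semifield, $F_+$ its positive cone, and $G:\Gamma(F)\text{-}\mathrm{Mod}\to F_+\text{-}\mathrm{Mod}$ the functor of restriction of scalars along the onto semiring homomorphism $\gamma:F_+\to\Gamma(F)^{\wedge\oplus}$, $\gamma(a)=a\wedge u$. Then $G$ is a full embedding and its left adjoint $G_l$ is its left inverse, i.e. $G_l\circ G$ is naturally isomorphic to the identity functor of $\Gamma(F)\text{-}\mathrm{Mod}$.
   Context: A semiring $\langle S,+,\cdot,0,1\rangle$: $\langle S,+,0\rangle$ is a commutative monoid, $\langle S,\cdot,1\rangle$ is a monoid, $\cdot$ distributes over $+$ from both sides, and $0$ is absorbing for $\cdot$. It is idempotent if $x+x=x$, and a semifield if $S\setminus\{0\}$ is an Abelian group under $\cdot$. A semimodule over $S$ is a commutative monoid with a scalar multiplication by $S$ satisfying $(ab)x=a(bx)$, $a(x+y)=ax+ay$, $(a+b)x=ax+bx$, $0_S x=0=a0$, $1x=x$; $S\text{-}\mathrm{Mod}$ is the category of (left) $S$-semimodules and $S$-semimodule homomorphisms. An idempotent $u$-semifield $\langle F,\wedge,+,-,\top,0,u\rangle$ is an idempotent semifield whose semiring sum is $\wedge$ (with neutral element $\top$), whose semiring product is $+$ (with unit $0$), ordered by $x\le y$ iff $x\wedge y=x$, so that $F\setminus\{\top\}$ is a lattice-ordered Abelian group, with a distinguished strong order unit $u$: $0<u<\top$ and for every $x\in F\setminus\{\top\}$ with $x>0$ there is a positive integer $n$ with $nu>x$. $F_+=\{x\in F: x\ge 0\}$, a subsemiring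 of $F$. $\Gamma(F)$ is the MV-algebra $\langle[0,u],\oplus,{}^*,0\rangle$ with $x\oplus y=(x+y)\wedge u$, $x^*=u-x$, and $\Gamma(F)^{\wedge\oplus}$ is the semiring $\langle[0,u],\wedge,\oplus,u,0\rangle$ (sum $\wedge$ with zero $u$, product $\oplus$ with unit $0$). $\Gamma(F)\text{-}\mathrm{Mod}$ is the category of semimodules over $\Gamma(F)^{\wedge\oplus}$. $G$ sends a $\Gamma(F)$-semimodule $N$ to the $F_+$-semimodule with the same underlying monoid and scalar multiplication $a\cdot_\gamma x=\gamma(a)\cdot x$, and is the identity on underlying maps. A full embedding is a functor that is full and injective on morphisms. $G_l$ denotes the left adjoint of $G$, $G_l(M)=\Gamma(F)\otimes_{F_+}M$. *)

theory Defs
  imports "HOL-Algebra.Module" "HOL-Library.Multiset" "HOL-Library.FuncSet"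
begin

section \<open>Categories and functors\<close>

record ('o, 'a) cat =
  Obj :: "'o set"
  Arr :: "'a set"
  Dom :: "'a \<Rightarrow> 'o"
  Cod :: "'a \<Rightarrow> 'o"
  Idn :: "'o \<Rightarrow> 'a"
  Cmp :: "'a \<Rightarrow> 'a \<Rightarrow> 'a"  \<comment> \<open>\<open>Cmp C g f\<close> is \<open>g\<close> after \<open>f\<close>\<close>

locale category =
  fixes C :: "('o, 'a) cat"
  assumes Dom_Obj: "f \<in> Arr C \<Longrightarrow> Dom C f \<in> Obj C"
    and Cod_Obj: "f \<in> Arr C \<Longrightarrow> Cod C f \<in> Obj C"
    and Idn_Arr: "X \<in> Obj C \<Longrightarrow> Idn C X \<in> Arr C"
    and Dom_Idn: "X \<in> Obj C \<Longrightarrow> Dom C (Idn C X) = X"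
    and Cod_Idn: "X \<in> Obj C \<Longrightarrow> Cod C (Idn C X) = X"
    and Cmp_Arr: "\<lbrakk>f \<in> Arr C; g \<in> Arr C; Cod C f = Dom C g\<rbrakk> \<Longrightarrow> Cmp C g f \<in> Arr C"
    and Dom_Cmp: "\<lbrakk>f \<in> Arr C; g \<in> Arr C; Cod C f = Dom C g\<rbrakk> \<Longrightarrow> Dom C (Cmp C g f) = Dom C f"
    and Cod_Cmp: "\<lbrakk>f \<in> Arr C; g \<in> Arr C; Cod C f = Dom C g\<rbrakk> \<Longrightarrow> Cod C (Cmp C g f) = Cod C g"
    and Cmp_Idn_left: "f \<in> Arr C \<Longrightarrow> Cmp C (Idn C (Cod C f)) f = f"
    and Cmp_Idn_right: "f \<in> Arr C \<Longrightarrow> Cmp C f (Idn C (Dom C f)) = f"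
    and Cmp_assoc: "\<lbrakk>f \<in> Arr C; g \<in> Arr C; h \<in> Arr C; Cod C f = Dom C g; Cod C g = Dom C h\<rbrakk>
      \<Longrightarrow> Cmp C h (Cmp C g f) = Cmp C (Cmp C h g) f"

record ('o, 'a, 'p, 'b) cfun =
  on_obj :: "'o \<Rightarrow> 'p"
  on_arr :: "'a \<Rightarrow> 'b"

locale cat_functor = C: category C + D: category D
  for C :: "('o, 'a) cat" and D :: "('p, 'b) cat" +
  fixes T :: "('o, 'a, 'p, 'b) cfun"
  assumes on_obj_Obj: "X \<in> Obj C \<Longrightarrow> on_obj T X \<in> Obj D"
    and on_arr_Arr: "f \<in> Arr C \<Longrightarrow> on_arr T f \<in> Arr D"
    and Dom_on_arr: "f \<in> Arr C \<Longrightarrow> Dom D (on_arr T f) = on_obj T (Dom C f)"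
    and Cod_on_arr: "f \<in> Arr C \<Longrightarrow> Cod D (on_arr T f) = on_obj T (Cod C f)"
    and on_arr_Idn: "X \<in> Obj C \<Longrightarrow> on_arr T (Idn C X) = Idn D (on_obj T X)"
    and on_arr_Cmp: "\<lbrakk>f \<in> Arr C; g \<in> Arr C; Cod C f = Dom C g\<rbrakk>
      \<Longrightarrow> on_arr T (Cmp C g f) = Cmp D (on_arr T g) (on_arr T f)"

definition id_cfun :: "('o, 'a, 'o, 'a) cfun" where
  "id_cfun = \<lparr>on_obj = (\<lambda>X. X), on_arr = (\<lambda>f. f)\<rparr>"

definition comp_cfun ::
    "('p, 'b, 'q, 'c) cfun \<Rightarrow> ('o, 'a, 'p, 'b) cfun \<Rightarrow> ('o, 'a, 'q, 'c) cfun" where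
  "comp_cfun T S = \<lparr>on_obj = (\<lambda>X. on_obj T (on_obj S X)), on_arr = (\<lambda>f. on_arr T (on_arr S f))\<rparr>"

definition full_functor ::
    "('o, 'a) cat \<Rightarrow> ('p, 'b) cat \<Rightarrow> ('o, 'a, 'p, 'b) cfun \<Rightarrow> bool" where
  "full_functor C D T \<longleftrightarrow> cat_functor C D T \<and>
    (\<forall>X\<in>Obj C. \<forall>Y\<in>Obj C. \<forall>g\<in>Arr D. Dom D g = on_obj T X \<and> Cod D g = on_obj T Y \<longrightarrow>
      (\<exists>f\<in>Arr C. Dom C f = X \<and> Cod C f = Y \<and> on_arr T f = g))"

text \<open>Injectivity is on the class of all morphisms, not just on each hom-set (faithfulness); since
  identities are morphisms, it includes injectivity on objects.\<close>

definition full_embedding ::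
    "('o, 'a) cat \<Rightarrow> ('p, 'b) cat \<Rightarrow> ('o, 'a, 'p, 'b) cfun \<Rightarrow> bool" where
  "full_embedding C D T \<longleftrightarrow> full_functor C D T \<and> inj_on (on_arr T) (Arr C)"


section \<open>Semimodules\<close>

locale semimodule = S: semiring S + M: abelian_monoid M
  for S :: "('s, 'e) ring_scheme" (structure) and M :: "('s, 'm, 'f) module_scheme" (structure) +
  assumes smult_closed: "\<lbrakk>a \<in> carrier S; x \<in> carrier M\<rbrakk> \<Longrightarrow> a \<odot>\<^bsub>M\<^esub> x \<in> carrier M"
    and smult_assoc: "\<lbrakk>a \<in> carrier S; b \<in> carrier S; x \<in> carrier M\<rbrakk>
      \<Longrightarrow> (a \<otimes>\<^bsub>S\<^esub> b) \<odot>\<^bsub>M\<^esub> x = a \<odot>\<^bsub>M\<^esub> (b \<odot>\<^bsub>M\<^esub> x)"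
    and smult_r_distr: "\<lbrakk>a \<in> carrier S; x \<in> carrier M; y \<in> carrier M\<rbrakk>
      \<Longrightarrow> a \<odot>\<^bsub>M\<^esub> (x \<oplus>\<^bsub>M\<^esub> y) = a \<odot>\<^bsub>M\<^esub> x \<oplus>\<^bsub>M\<^esub> a \<odot>\<^bsub>M\<^esub> y"
    and smult_l_distr: "\<lbrakk>a \<in> carrier S; b \<in> carrier S; x \<in> carrier M\<rbrakk>
      \<Longrightarrow> (a \<oplus>\<^bsub>S\<^esub> b) \<odot>\<^bsub>M\<^esub> x = a \<odot>\<^bsub>M\<^esub> x \<oplus>\<^bsub>M\<^esub> b \<odot>\<^bsub>M\<^esub> x"
    and smult_zero_left: "x \<in> carrier M \<Longrightarrow> \<zero>\<^bsub>S\<^esub> \<odot>\<^bsub>M\<^esub> x = \<zero>\<^bsub>M\<^esub>"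
    and smult_zero_right: "a \<in> carrier S \<Longrightarrow> a \<odot>\<^bsub>M\<^esub> \<zero>\<^bsub>M\<^esub> = \<zero>\<^bsub>M\<^esub>"
    and smult_one: "x \<in> carrier M \<Longrightarrow> \<one>\<^bsub>S\<^esub> \<odot>\<^bsub>M\<^esub> x = x"

text \<open>The record type \<open>module\<close> has superfluous fields \<open>mult\<close> and \<open>one\<close>, and its operations are
  total functions. Both are normalised here, so that equality of records is equality of
  semimodules; otherwise two records could differ in values that are not part of the semimodule.\<close>

definition canonical_semimodule :: "'s ring \<Rightarrow> ('s, 'm) module \<Rightarrow> bool" where
  "canonical_semimodule S M \<longleftrightarrow> semimodule S M \<and>
    add M \<in> carrier M \<rightarrow>\<^sub>E carrier M \<rightarrow>\<^sub>E carrier M \<and>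
    smult M \<in> carrier S \<rightarrow>\<^sub>E carrier M \<rightarrow>\<^sub>E carrier M \<and>
    monoid.mult M = undefined \<and> one M = undefined"

definition semimodule_hom ::
    "'s ring \<Rightarrow> ('s, 'm) module \<Rightarrow> ('s, 'n) module \<Rightarrow> ('m \<Rightarrow> 'n) set" where
  "semimodule_hom S M N = {f \<in> carrier M \<rightarrow>\<^sub>E carrier N.
    (\<forall>x\<in>carrier M. \<forall>y\<in>carrier M. f (x \<oplus>\<^bsub>M\<^esub> y) = f x \<oplus>\<^bsub>N\<^esub> f y) \<and>
    f \<zero>\<^bsub>M\<^esub> = \<zero>\<^bsub>N\<^esub> \<and>
    (\<forall>a\<in>carrier S. \<forall>x\<in>carrier M. f (a \<odot>\<^bsub>M\<^esub> x) = a \<odot>\<^bsub>N\<^esub> f x)}"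

definition semimodule_iso ::
    "'s ring \<Rightarrow> ('s, 'm) module \<Rightarrow> ('s, 'n) module \<Rightarrow> ('m \<Rightarrow> 'n) set" where
  "semimodule_iso S M N = {f \<in> semimodule_hom S M N. \<exists>g\<in>semimodule_hom S N M.
    (\<forall>x\<in>carrier M. g (f x) = x) \<and> (\<forall>y\<in>carrier N. f (g y) = y)}"

text \<open>A morphism is a triple of domain, underlying map and codomain.\<close>

type_synonym ('s, 'm) smod_arr = "('s, 'm) module \<times> ('m \<Rightarrow> 'm) \<times> ('s, 'm) module"
type_synonym ('s, 'm) smod_cat = "(('s, 'm) module, ('s, 'm) smod_arr) cat"
type_synonym ('s, 'm, 't, 'n) smod_fun =
  "(('s, 'm) module, ('s, 'm) smod_arr, ('t, 'n) module, ('t, 'n) smod_arr) cfun"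

abbreviation umap :: "('s, 'm) smod_arr \<Rightarrow> 'm \<Rightarrow> 'm" where
  "umap h \<equiv> fst (snd h)"

text \<open>\<open>SMod S :: ('s, 'm) smod_cat\<close> is the category \<open>S\<close>-Mod, the underlying sets of the
  semimodules being subsets of the type \<open>'m\<close>.\<close>

definition SMod :: "'s ring \<Rightarrow> ('s, 'm) smod_cat" where
  "SMod S = \<lparr>
    Obj = {M. canonical_semimodule S M},
    Arr = {(M, f, N). canonical_semimodule S M \<and> canonical_semimodule S N \<and>
                      f \<in> semimodule_hom S M N},
    Dom = (\<lambda>(M, f, N). M),
    Cod = (\<lambda>(M, f, N). N),
    Idn = (\<lambda>M. (M, restrict (\<lambda>x. x) (carrier M), M)),
    Cmp = (\<lambda>(N, g, P) (M, f, N'). (M, compose (carrier M) g f, P))\<rparr>"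

text \<open>A construction such as the tensor product changes the type of the elements. Hence
  natural transformations and adjunctions are formulated by means of semimodule homomorphisms whose
  domain and codomain may live on different types.\<close>

definition smod_natural_iso ::
    "('o, 'a) cat \<Rightarrow> 's ring \<Rightarrow>
     ('o, 'a, ('s, 'm) module, ('s, 'm) smod_arr) cfun \<Rightarrow>
     ('o, 'a, ('s, 'n) module, ('s, 'n) smod_arr) cfun \<Rightarrow> ('o \<Rightarrow> 'm \<Rightarrow> 'n) \<Rightarrow> bool" where
  "smod_natural_iso C S T U \<theta> \<longleftrightarrow>
    cat_functor C (SMod S) T \<and> cat_functor C (SMod S) U \<and>
    (\<forall>X\<in>Obj C. \<theta> X \<in> semimodule_iso S (on_obj T X) (on_obj U X)) \<and>
    (\<forall>h\<in>Arr C. \<forall>x\<in>carrier (on_obj T (Dom C h)).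
      \<theta> (Cod C h) (umap (on_arr T h) x) = umap (on_arr U h) (\<theta> (Dom C h) x))"

text \<open>\<open>L\<close> is left adjoint to \<open>G\<close>: there are bijections
  \<open>\<Phi> M N : Hom\<^sub>S(L M, N) \<rightarrow> Hom\<^sub>R(M, G N)\<close>, natural in \<open>M\<close> and \<open>N\<close>.\<close>

definition smod_adjunction ::
    "'r ring \<Rightarrow> 's ring \<Rightarrow> ('r, 'm, 's, 'p) smod_fun \<Rightarrow> ('s, 'n, 'r, 'q) smod_fun \<Rightarrow>
     (('r, 'm) module \<Rightarrow> ('s, 'n) module \<Rightarrow> ('p \<Rightarrow> 'n) \<Rightarrow> ('m \<Rightarrow> 'q)) \<Rightarrow> bool" where
  "smod_adjunction R S L G \<Phi> \<longleftrightarrow>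
    cat_functor (SMod R) (SMod S) L \<and> cat_functor (SMod S) (SMod R) G \<and>
    (\<forall>M\<in>Obj (SMod R). \<forall>N\<in>Obj (SMod S).
      bij_betw (\<Phi> M N) (semimodule_hom S (on_obj L M) N) (semimodule_hom R M (on_obj G N))) \<and>
    (\<forall>h\<in>Arr (SMod R). \<forall>k\<in>Arr (SMod S).
      \<forall>g\<in>semimodule_hom S (on_obj L (Cod (SMod R) h)) (Dom (SMod S) k).
      \<forall>x\<in>carrier (Dom (SMod R) h).
        \<Phi> (Dom (SMod R) h) (Cod (SMod S) k)
          (compose (carrier (on_obj L (Dom (SMod R) h))) (umap k)
            (compose (carrier (on_obj L (Dom (SMod R) h))) g (umap (on_arr L h)))) x
        = umap (on_arr G k) (\<Phi> (Cod (SMod R) h) (Dom (SMod S) k) g (umap h x)))"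


section \<open>Restriction and extension of scalars\<close>

text \<open>The library's \<open>ring_hom\<close> does not require preservation of \<open>\<zero>\<close>, which is not automatic for
  semirings.\<close>

definition semiring_hom :: "'r ring \<Rightarrow> 's ring \<Rightarrow> ('r \<Rightarrow> 's) set" where
  "semiring_hom R S = {\<phi> \<in> ring_hom R S. \<phi> \<zero>\<^bsub>R\<^esub> = \<zero>\<^bsub>S\<^esub>}"

definition restr_obj :: "'r ring \<Rightarrow> ('r \<Rightarrow> 's) \<Rightarrow> ('s, 'n) module \<Rightarrow> ('r, 'n) module" where
  "restr_obj R \<phi> N = \<lparr>carrier = carrier N, monoid.mult = monoid.mult N, one = one N,
    zero = zero N, add = add N, smult = (\<lambda>a\<in>carrier R. smult N (\<phi> a))\<rparr>"

definition restr_scalars :: "'r ring \<Rightarrow> ('r \<Rightarrow> 's) \<Rightarrow> ('s, 'n, 'r, 'n) smod_fun" where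
  "restr_scalars R \<phi> = \<lparr>on_obj = restr_obj R \<phi>,
    on_arr = (\<lambda>(M, f, N). (restr_obj R \<phi> M, f, restr_obj R \<phi> N))\<rparr>"

text \<open>\<open>S \<otimes>\<^sub>R M\<close>, where \<open>\<phi> : R \<rightarrow> S\<close> makes \<open>S\<close> a right \<open>R\<close>-semimodule: the free commutative
  monoid of finite multisets (formal sums) of elements of \<open>S \<times> M\<close>, modulo the congruence generated
  by the usual relations.\<close>

definition formal_sums :: "'s ring \<Rightarrow> ('r, 'm) module \<Rightarrow> ('s \<times> 'm) multiset set" where
  "formal_sums S M = {X. set_mset X \<subseteq> carrier S \<times> carrier M}"

inductive tensor_cong ::
    "'r ring \<Rightarrow> 's ring \<Rightarrow> ('r \<Rightarrow> 's) \<Rightarrow> ('r, 'm) module \<Rightarrow>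
     ('s \<times> 'm) multiset \<Rightarrow> ('s \<times> 'm) multiset \<Rightarrow> bool"
  for R :: "'r ring" and S :: "'s ring" and \<phi> :: "'r \<Rightarrow> 's" and M :: "('r, 'm) module"
where
  add_left: "\<lbrakk>s \<in> carrier S; t \<in> carrier S; x \<in> carrier M\<rbrakk>
    \<Longrightarrow> tensor_cong R S \<phi> M {#(s \<oplus>\<^bsub>S\<^esub> t, x)#} {#(s, x), (t, x)#}"
| add_right: "\<lbrakk>s \<in> carrier S; x \<in> carrier M; y \<in> carrier M\<rbrakk>
    \<Longrightarrow> tensor_cong R S \<phi> M {#(s, x \<oplus>\<^bsub>M\<^esub> y)#} {#(s, x), (s, y)#}"
| zero_left: "x \<in> carrier M \<Longrightarrow> tensor_cong R S \<phi> M {#(\<zero>\<^bsub>S\<^esub>, x)#} {#}"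
| zero_right: "s \<in> carrier S \<Longrightarrow> tensor_cong R S \<phi> M {#(s, \<zero>\<^bsub>M\<^esub>)#} {#}"
| balanced: "\<lbrakk>s \<in> carrier S; a \<in> carrier R; x \<in> carrier M\<rbrakk>
    \<Longrightarrow> tensor_cong R S \<phi> M {#(s \<otimes>\<^bsub>S\<^esub> \<phi> a, x)#} {#(s, a \<odot>\<^bsub>M\<^esub> x)#}"
| refl: "X \<in> formal_sums S M \<Longrightarrow> tensor_cong R S \<phi> M X X"
| sym: "tensor_cong R S \<phi> M X Y \<Longrightarrow> tensor_cong R S \<phi> M Y X"
| trans: "\<lbrakk>tensor_cong R S \<phi> M X Y; tensor_cong R S \<phi> M Y Z\<rbrakk> \<Longrightarrow> tensor_cong R S \<phi> M X Z"
| sum: "\<lbrakk>tensor_cong R S \<phi> M X Y; tensor_cong R S \<phi> M X' Y'\<rbrakk>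
    \<Longrightarrow> tensor_cong R S \<phi> M (X + X') (Y + Y')"

definition tensor_class ::
    "'r ring \<Rightarrow> 's ring \<Rightarrow> ('r \<Rightarrow> 's) \<Rightarrow> ('r, 'm) module \<Rightarrow>
     ('s \<times> 'm) multiset \<Rightarrow> ('s \<times> 'm) multiset set" where
  "tensor_class R S \<phi> M X = {Y. tensor_cong R S \<phi> M X Y}"

text \<open>The unions below run over representatives of the argument classes; as all members yield the
  same class, each union is that class.\<close>

definition ext_obj ::
    "'r ring \<Rightarrow> 's ring \<Rightarrow> ('r \<Rightarrow> 's) \<Rightarrow> ('r, 'm) module \<Rightarrow>
     ('s, ('s \<times> 'm) multiset set) module" where
  "ext_obj R S \<phi> M = (let Q = tensor_class R S \<phi> M ` formal_sums S M in
    \<lparr>carrier = Q,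
     monoid.mult = undefined,
     one = undefined,
     zero = tensor_class R S \<phi> M {#},
     add = (\<lambda>A\<in>Q. \<lambda>B\<in>Q. \<Union>X\<in>A. \<Union>Y\<in>B. tensor_class R S \<phi> M (X + Y)),
     smult = (\<lambda>s\<in>carrier S. \<lambda>A\<in>Q.
       \<Union>X\<in>A. tensor_class R S \<phi> M (image_mset (\<lambda>(t, x). (s \<otimes>\<^bsub>S\<^esub> t, x)) X))\<rparr>)"

definition ext_map ::
    "'r ring \<Rightarrow> 's ring \<Rightarrow> ('r \<Rightarrow> 's) \<Rightarrow> ('r, 'm) module \<Rightarrow> ('m \<Rightarrow> 'n) \<Rightarrow> ('r, 'n) module \<Rightarrow>
     ('s \<times> 'm) multiset set \<Rightarrow> ('s \<times> 'n) multiset set" where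
  "ext_map R S \<phi> M f N = (\<lambda>A\<in>carrier (ext_obj R S \<phi> M).
    \<Union>X\<in>A. tensor_class R S \<phi> N (image_mset (\<lambda>(t, x). (t, f x)) X))"

definition ext_scalars ::
    "'r ring \<Rightarrow> 's ring \<Rightarrow> ('r \<Rightarrow> 's) \<Rightarrow> ('r, 'm, 's, ('s \<times> 'm) multiset set) smod_fun" where
  "ext_scalars R S \<phi> = \<lparr>on_obj = ext_obj R S \<phi>,
    on_arr = (\<lambda>(M, f, N). (ext_obj R S \<phi> M, ext_map R S \<phi> M f N, ext_obj R S \<phi> N))\<rparr>"


section \<open>Idempotent \<open>u\<close>-semifields\<close>

text \<open>In the record \<open>F\<close>, \<open>\<oplus>\<close> is the meet, \<open>\<zero>\<close> is \<open>\<top>\<close>, \<open>\<otimes>\<close> is the sum of the lattice-ordered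
  group and \<open>\<one>\<close> is its zero element; \<open>u [^] n\<close> is the multiple \<open>nu\<close>.\<close>

locale idempotent_semifield = semiring F for F :: "'a ring" (structure) +
  assumes idem: "x \<in> carrier F \<Longrightarrow> x \<oplus> x = x"
    and nonzero_comm_group: "comm_group (F\<lparr>carrier := carrier F - {\<zero>}\<rparr>)"

definition meet_le :: "'a ring \<Rightarrow> 'a \<Rightarrow> 'a \<Rightarrow> bool" where
  "meet_le F x y \<longleftrightarrow> x \<oplus>\<^bsub>F\<^esub> y = x"

definition meet_less :: "'a ring \<Rightarrow> 'a \<Rightarrow> 'a \<Rightarrow> bool" where
  "meet_less F x y \<longleftrightarrow> meet_le F x y \<and> x \<noteq> y"

locale idempotent_u_semifield = idempotent_semifield F
  for F :: "'a ring" (structure) and u :: 'a +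
  assumes u_closed: "u \<in> carrier F"
    and u_pos: "meet_less F \<one> u"
    and u_less_top: "meet_less F u \<zero>"
    and strong_unit: "\<lbrakk>x \<in> carrier F - {\<zero>}; meet_less F \<one> x\<rbrakk>
      \<Longrightarrow> \<exists>n::nat. n > 0 \<and> meet_less F x (u [^] n)"

definition pos_cone :: "'a ring \<Rightarrow> 'a ring" where
  "pos_cone F = F\<lparr>carrier := {x \<in> carrier F. meet_le F \<one>\<^bsub>F\<^esub> x}\<rparr>"

text \<open>The semiring reduct, with sum \<open>\<and>\<close> and product \<open>x \<oplus> y = (x + y) \<and> u\<close>, of the MV-algebra
  \<open>\<Gamma>(F)\<close> on \<open>[0, u]\<close>.\<close>

definition Gamma :: "'a ring \<Rightarrow> 'a \<Rightarrow> 'a ring" where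
  "Gamma F u = \<lparr>carrier = {x \<in> carrier F. meet_le F \<one>\<^bsub>F\<^esub> x \<and> meet_le F x u},
    monoid.mult = (\<lambda>x y. (x \<otimes>\<^bsub>F\<^esub> y) \<oplus>\<^bsub>F\<^esub> u), one = \<one>\<^bsub>F\<^esub>, zero = u, add = add F\<rparr>"

definition gamma :: "'a ring \<Rightarrow> 'a \<Rightarrow> 'a \<Rightarrow> 'a" where
  "gamma F u a = a \<oplus>\<^bsub>F\<^esub> u"

definition G :: "'a ring \<Rightarrow> 'a \<Rightarrow> ('a, 'n, 'a, 'n) smod_fun" where
  "G F u = restr_scalars (pos_cone F) (gamma F u)"

definition G_l :: "'a ring \<Rightarrow> 'a \<Rightarrow> ('a, 'm, 'a, ('a \<times> 'm) multiset set) smod_fun" where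
  "G_l F u = ext_scalars (pos_cone F) (Gamma F u) (gamma F u)"

end

theory Submission
  imports Defs
begin

text \<open>Almost everything here holds for an arbitrary homomorphism of semirings \<open>\<phi> : R \<rightarrow> S\<close>, and \<open>\<gamma>\<close>
  enters only through being a surjective one.

  Along any \<open>\<phi>\<close>, restriction of scalars is right adjoint to extension of scalars. The unit sends \<open>x\<close>
  to \<open>1 \<otimes> x\<close>. A homomorphism out of \<open>S \<otimes> M\<close> is determined by its values on the elements \<open>1 \<otimes> x\<close>,
  because \<open>s \<otimes> x = s (1 \<otimes> x)\<close> and these elements span (\<open>tensor_hom_eqI\<close>); conversely every
  \<open>R\<close>-homomorphism \<open>f\<close> from \<open>M\<close> to the restriction of \<open>N\<close> extends to the map that sends a formal sum
  of pairs \<open>(s, x)\<close> to the sum of the \<open>s f(x)\<close>, which respects the defining relations of the tensor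
  product (\<open>tensor_lift_hom\<close>).

  If \<open>\<phi>\<close> is onto, every scalar of \<open>S\<close> is some \<open>\<phi> a\<close>. Hence the \<open>R\<close>-action determines the \<open>S\<close>-action,
  and an \<open>R\<close>-homomorphism between restrictions is already \<open>S\<close>-linear: restriction is a full embedding
  (\<open>full_embedding_restr\<close>). For the same reason the unit \<open>N \<rightarrow> S \<otimes> N\<close> is \<open>S\<close>-linear, so it is an inverse
  of the counit \<open>s \<otimes> x \<mapsto> s x\<close>, and the counit is a natural isomorphism (\<open>counit_natural_iso\<close>).

  What remains about \<open>F\<close> is that \<open>\<gamma>(a) = a \<and> u\<close> is a homomorphism of semirings onto \<open>\<Gamma>(F)\<close>. The point
  is that cutting a factor down to \<open>u\<close> does not alter a product of positive elements cut down to \<open>u\<close>,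
  since \<open>u + y \<ge> u\<close> for \<open>y \<ge> 0\<close>.\<close>

section \<open>The semirings of the positive cone and of the unit interval\<close>

context idempotent_u_semifield
begin

text \<open>\<open>\<one> \<oplus> x = \<one>\<close> says that \<open>x\<close> is positive. Expanding \<open>(\<one> \<oplus> x) \<otimes> (\<one> \<oplus> y)\<close> writes \<open>\<one>\<close> as a meet that has
  \<open>x \<otimes> y\<close> among its members.\<close>

lemma one_meet_mult:
  assumes "x \<in> carrier F" "y \<in> carrier F" "\<one> \<oplus> x = \<one>" "\<one> \<oplus> y = \<one>"
  shows "\<one> \<oplus> x \<otimes> y = \<one>"
proof -
  have "\<one> = (\<one> \<oplus> x) \<otimes> (\<one> \<oplus> y)" using assms by simp
  also have "\<dots> = (\<one> \<oplus> y) \<oplus> (x \<oplus> x \<otimes> y)"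
    using assms(1,2) by (simp add: l_distr r_distr add.m_ac)
  also have "\<dots> = (\<one> \<oplus> x) \<oplus> x \<otimes> y" using assms a_assoc[of \<one> x "x \<otimes> y"] by simp
  also have "\<dots> = \<one> \<oplus> x \<otimes> y" using assms by simp
  finally show ?thesis by simp
qed

lemma one_meet_meet:
  assumes "x \<in> carrier F" "y \<in> carrier F" "\<one> \<oplus> x = \<one>" "\<one> \<oplus> y = \<one>"
  shows "\<one> \<oplus> (x \<oplus> y) = \<one>"
  using assms a_assoc[of \<one> x y] by simp

lemma one_meet_u: "\<one> \<oplus> u = \<one>"
  using u_pos by (simp add: meet_less_def meet_le_def)

text \<open>Translation by \<open>u\<close> is monotone, so \<open>\<one> \<le> x\<close> gives \<open>u \<le> x \<otimes> u\<close>; algebraically this is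
  distributivity applied to \<open>(x \<oplus> \<one>) \<otimes> u\<close>.\<close>

lemma mult_u_meet_u:
  assumes "x \<in> carrier F" "\<one> \<oplus> x = \<one>"
  shows "x \<otimes> u \<oplus> u = u" "u \<otimes> x \<oplus> u = u"
proof -
  have "x \<oplus> \<one> = \<one>" using assms a_comm by simp
  then have "(x \<oplus> \<one>) \<otimes> u = u" "u \<otimes> (x \<oplus> \<one>) = u"
    using u_closed by simp_all
  then show "x \<otimes> u \<oplus> u = u" "u \<otimes> x \<oplus> u = u"
    using assms(1) u_closed by (simp_all add: l_distr r_distr)
qed

text \<open>This and its mirror image give both the associativity of the truncated product of \<open>\<Gamma>(F)\<close> and the
  multiplicativity of \<open>\<gamma>\<close>: the extra term \<open>u \<otimes> y\<close> lies above \<open>u\<close> and is absorbed.\<close>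

lemma truncate_mult_truncate_left:
  assumes "x \<in> carrier F" "y \<in> carrier F" "\<one> \<oplus> y = \<one>"
  shows "(x \<oplus> u) \<otimes> y \<oplus> u = x \<otimes> y \<oplus> u"
  using assms u_closed by (simp add: l_distr a_assoc mult_u_meet_u)

lemma truncate_mult_truncate_right:
  assumes "x \<in> carrier F" "y \<in> carrier F" "\<one> \<oplus> x = \<one>"
  shows "x \<otimes> (y \<oplus> u) \<oplus> u = x \<otimes> y \<oplus> u"
  using assms u_closed by (simp add: r_distr a_assoc mult_u_meet_u)

lemma semiring_pos_cone: "semiring (pos_cone F)"
  unfolding pos_cone_def meet_le_def
proof (intro semiring.intro abelian_monoidI monoidI semiring_axioms.intro, goal_cases)
  \<comment> \<open>commutativity of the meet\<close>
  case (5 x y)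
  then show ?case by (auto intro: a_comm)
qed (auto simp: one_meet_mult one_meet_meet a_assoc m_assoc l_distr r_distr idem)

lemma truncate_meet_truncate:
  assumes "x \<in> carrier F" "y \<in> carrier F"
  shows "(x \<oplus> u) \<oplus> (y \<oplus> u) = (x \<oplus> y) \<oplus> u"
proof -
  have "(x \<oplus> u) \<oplus> (y \<oplus> u) = (x \<oplus> y) \<oplus> (u \<oplus> u)"
    using assms u_closed by (simp add: add.m_ac)
  then show ?thesis using u_closed by (simp add: idem)
qed

lemma truncate_truncate:
  assumes "x \<in> carrier F"
  shows "x \<oplus> u \<oplus> u = x \<oplus> u"
  using assms u_closed by (simp add: a_assoc idem)

lemma semiring_Gamma: "semiring (Gamma F u)"
  unfolding Gamma_def meet_le_def
proof (intro semiring.intro abelian_monoidI monoidI semiring_axioms.intro, goal_cases)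
  \<comment> \<open>closure under the meet\<close>
  case (1 x y)
  then show ?case using u_closed by (auto simp: one_meet_meet a_assoc)
next
  \<comment> \<open>\<open>u\<close> is neutral for the meet\<close>
  case (4 x)
  then show ?case using u_closed a_comm[of u x] by auto
next
  \<comment> \<open>commutativity of the meet\<close>
  case (5 x y)
  then show ?case by (auto intro: a_comm)
next
  \<comment> \<open>associativity of the truncated product\<close>
  case (8 x y z)
  then show ?case
    using u_closed by (auto simp: one_meet_mult truncate_mult_truncate_left
        truncate_mult_truncate_right m_assoc)
next
  \<comment> \<open>distributivity from the right\<close>
  case (11 x y z)
  then show ?case
    using u_closed by (auto simp: truncate_meet_truncate l_distr)
next
  \<comment> \<open>distributivity from the left\<close>
  case (12 x y z)
  then show ?case
    using u_closed by (auto simp: truncate_meet_truncate r_distr)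
qed (use u_closed in \<open>auto simp: one_meet_mult one_meet_meet one_meet_u truncate_truncate a_assoc idem
       mult_u_meet_u\<close>)

lemma gamma_semiring_hom: "gamma F u \<in> semiring_hom (pos_cone F) (Gamma F u)"
  unfolding semiring_hom_def ring_hom_def pos_cone_def Gamma_def gamma_def meet_le_def
  using u_closed
  by (auto simp: one_meet_meet one_meet_u truncate_truncate truncate_meet_truncate
      truncate_mult_truncate_left truncate_mult_truncate_right)

lemma gamma_surj: "gamma F u ` carrier (pos_cone F) = carrier (Gamma F u)"
proof
  show "gamma F u ` carrier (pos_cone F) \<subseteq> carrier (Gamma F u)"
    using gamma_semiring_hom by (auto simp: semiring_hom_def ring_hom_def)
  show "carrier (Gamma F u) \<subseteq> gamma F u ` carrier (pos_cone F)"
    by (force simp: Gamma_def gamma_def pos_cone_def meet_le_def image_iff)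
qed

end


section \<open>The category of semimodules\<close>

lemma SMod_simps [simp]:
  "M \<in> Obj (SMod S) \<longleftrightarrow> canonical_semimodule S M"
  "(M, f, N) \<in> Arr (SMod S) \<longleftrightarrow>
    canonical_semimodule S M \<and> canonical_semimodule S N \<and> f \<in> semimodule_hom S M N"
  "Dom (SMod S) (M, f, N) = M"
  "Cod (SMod S) (M, f, N) = N"
  "Idn (SMod S) M = (M, restrict (\<lambda>x. x) (carrier M), M)"
  "Cmp (SMod S) (N', g, P) (M, f, N) = (M, compose (carrier M) g f, P)"
  by (simp_all add: SMod_def)

lemma canonical_semimoduleD: "canonical_semimodule S M \<Longrightarrow> semimodule S M"
  by (simp add: canonical_semimodule_def)

lemma semimodule_hom_closed:
  "\<lbrakk>f \<in> semimodule_hom S M N; x \<in> carrier M\<rbrakk> \<Longrightarrow> f x \<in> carrier N"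
  by (auto simp: semimodule_hom_def)

lemma semimodule_hom_add:
  "\<lbrakk>f \<in> semimodule_hom S M N; x \<in> carrier M; y \<in> carrier M\<rbrakk> \<Longrightarrow> f (x \<oplus>\<^bsub>M\<^esub> y) = f x \<oplus>\<^bsub>N\<^esub> f y"
  by (auto simp: semimodule_hom_def)

lemma semimodule_hom_zero: "f \<in> semimodule_hom S M N \<Longrightarrow> f \<zero>\<^bsub>M\<^esub> = \<zero>\<^bsub>N\<^esub>"
  by (auto simp: semimodule_hom_def)

lemma semimodule_hom_smult:
  "\<lbrakk>f \<in> semimodule_hom S M N; a \<in> carrier S; x \<in> carrier M\<rbrakk> \<Longrightarrow> f (a \<odot>\<^bsub>M\<^esub> x) = a \<odot>\<^bsub>N\<^esub> f x"
  by (auto simp: semimodule_hom_def)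

lemma semimodule_hom_extensional: "f \<in> semimodule_hom S M N \<Longrightarrow> f \<in> extensional (carrier M)"
  by (auto simp: semimodule_hom_def PiE_def)

lemmas semimodule_hom_simps =
  semimodule_hom_closed semimodule_hom_add semimodule_hom_zero semimodule_hom_smult

lemma semimodule_homI:
  assumes "f \<in> extensional (carrier M)" "\<And>x. x \<in> carrier M \<Longrightarrow> f x \<in> carrier N"
    "\<And>x y. \<lbrakk>x \<in> carrier M; y \<in> carrier M\<rbrakk> \<Longrightarrow> f (x \<oplus>\<^bsub>M\<^esub> y) = f x \<oplus>\<^bsub>N\<^esub> f y"
    "f \<zero>\<^bsub>M\<^esub> = \<zero>\<^bsub>N\<^esub>"
    "\<And>a x. \<lbrakk>a \<in> carrier S; x \<in> carrier M\<rbrakk> \<Longrightarrow> f (a \<odot>\<^bsub>M\<^esub> x) = a \<odot>\<^bsub>N\<^esub> f x"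
  shows "f \<in> semimodule_hom S M N"
  using assms by (auto simp: semimodule_hom_def PiE_def)

lemma semimodule_hom_id:
  assumes "semimodule S M"
  shows "restrict (\<lambda>x. x) (carrier M) \<in> semimodule_hom S M M"
proof -
  interpret semimodule S M by fact
  show ?thesis by (rule semimodule_homI) (auto simp: smult_closed)
qed

lemma semimodule_hom_compose:
  assumes "semimodule S M" and f: "f \<in> semimodule_hom S M N" and g: "g \<in> semimodule_hom S N P"
  shows "compose (carrier M) g f \<in> semimodule_hom S M P"
proof -
  interpret semimodule S M by fact
  show ?thesis
    by (rule semimodule_homI) (auto simp: compose_eq smult_closed semimodule_hom_simps[OF f]
        semimodule_hom_simps[OF g])
qed

lemma category_SMod:
  fixes S :: "'s ring"
  shows "category (SMod S :: ('s, 'm) smod_cat)"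
proof
  fix f g h :: "('s, 'm) smod_arr"
  assume "f \<in> Arr (SMod S)" "g \<in> Arr (SMod S)" "h \<in> Arr (SMod S)"
    "Cod (SMod S) f = Dom (SMod S) g" "Cod (SMod S) g = Dom (SMod S) h"
  then show "Cmp (SMod S) h (Cmp (SMod S) g f) = Cmp (SMod S) (Cmp (SMod S) h g) f"
    by (cases f, cases g, cases h) (auto intro!: compose_assoc simp: semimodule_hom_closed)
next
  fix f :: "('s, 'm) smod_arr"
  assume "f \<in> Arr (SMod S)"
  then show "Cmp (SMod S) (Idn (SMod S) (Cod (SMod S) f)) f = f"
    and "Cmp (SMod S) f (Idn (SMod S) (Dom (SMod S) f)) = f"
    by (cases f, auto intro!: Id_compose compose_Id simp: semimodule_hom_closed
        semimodule_hom_extensional)+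
qed (auto simp: semimodule_hom_id semimodule_hom_compose canonical_semimoduleD)

lemma cat_functor_id: "category C \<Longrightarrow> cat_functor C C id_cfun"
  by (intro cat_functor.intro cat_functor_axioms.intro) (auto simp: id_cfun_def)

lemma cat_functor_comp:
  assumes "cat_functor C D T" "cat_functor D E U"
  shows "cat_functor C E (comp_cfun U T)"
proof -
  interpret T: cat_functor C D T by fact
  interpret U: cat_functor D E U by fact
  show ?thesis
    by unfold_locales (auto simp: comp_cfun_def T.on_obj_Obj T.on_arr_Arr T.Dom_on_arr T.Cod_on_arr
        T.on_arr_Idn T.on_arr_Cmp U.on_obj_Obj U.on_arr_Arr U.Dom_on_arr U.Cod_on_arr
        U.on_arr_Idn U.on_arr_Cmp)
qed


section \<open>Restriction of scalars\<close>

locale scalar_change =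
  fixes R :: "'r ring" and S :: "'s ring" and \<phi> :: "'r \<Rightarrow> 's"
  assumes semiring_R: "semiring R" and semiring_S: "semiring S"
    and hom: "\<phi> \<in> semiring_hom R S"
begin

sublocale R: semiring R by (rule semiring_R)
sublocale S: semiring S by (rule semiring_S)

lemma phi_closed [simp]: "a \<in> carrier R \<Longrightarrow> \<phi> a \<in> carrier S"
  using hom by (auto simp: semiring_hom_def ring_hom_def)

lemma phi_simps [simp]:
  "\<lbrakk>a \<in> carrier R; b \<in> carrier R\<rbrakk> \<Longrightarrow> \<phi> (a \<oplus>\<^bsub>R\<^esub> b) = \<phi> a \<oplus>\<^bsub>S\<^esub> \<phi> b"
  "\<lbrakk>a \<in> carrier R; b \<in> carrier R\<rbrakk> \<Longrightarrow> \<phi> (a \<otimes>\<^bsub>R\<^esub> b) = \<phi> a \<otimes>\<^bsub>S\<^esub> \<phi> b"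
  "\<phi> \<zero>\<^bsub>R\<^esub> = \<zero>\<^bsub>S\<^esub>" "\<phi> \<one>\<^bsub>R\<^esub> = \<one>\<^bsub>S\<^esub>"
  using hom by (auto simp: semiring_hom_def ring_hom_def)

lemma restr_obj_simps [simp]:
  "carrier (restr_obj R \<phi> N) = carrier N"
  "add (restr_obj R \<phi> N) = add N" "zero (restr_obj R \<phi> N) = zero N"
  "a \<in> carrier R \<Longrightarrow> smult (restr_obj R \<phi> N) a = smult N (\<phi> a)"
  by (simp_all add: restr_obj_def)

lemma semimodule_restr_obj:
  assumes "semimodule S N"
  shows "semimodule R (restr_obj R \<phi> N)"
proof -
  interpret N: semimodule S N by fact
  show ?thesis
    by (intro semimodule.intro semimodule_axioms.intro semiring_R abelian_monoidI)
      (auto simp: N.smult_closed N.smult_assoc N.smult_r_distr N.smult_l_distr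
        N.smult_zero_left N.smult_zero_right N.smult_one N.M.a_ac)
qed

lemma canonical_restr_obj:
  assumes "canonical_semimodule S N"
  shows "canonical_semimodule R (restr_obj R \<phi> N)"
  using assms semimodule_restr_obj[of N] unfolding canonical_semimodule_def
  by (auto simp: restr_obj_def)

lemma restr_hom:
  "f \<in> semimodule_hom S M N \<Longrightarrow> f \<in> semimodule_hom R (restr_obj R \<phi> M) (restr_obj R \<phi> N)"
  by (auto simp: semimodule_hom_def)

lemma cat_functor_restr: "cat_functor (SMod S) (SMod R) (restr_scalars R \<phi>)"
  by (intro cat_functor.intro category_SMod cat_functor_axioms.intro)
    (auto simp: restr_scalars_def canonical_restr_obj restr_hom)

end

locale surj_scalar_change = scalar_change R S \<phi>
  for R :: "'r ring" and S :: "'s ring" and \<phi> :: "'r \<Rightarrow> 's" +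
  assumes surj: "\<phi> ` carrier R = carrier S"
begin

text \<open>Linearity over \<open>S\<close> has to be tested on scalars of the form \<open>\<phi> a\<close> only.\<close>

lemma restr_hom_surj:
  assumes "f \<in> semimodule_hom R (restr_obj R \<phi> M) (restr_obj R \<phi> N)"
  shows "f \<in> semimodule_hom S M N"
  using assms unfolding semimodule_hom_def surj[symmetric] by auto

text \<open>The action of \<open>\<phi> a\<close> is read off from the action of \<open>a\<close>. Equality of records also needs the two
  scalar multiplications to agree outside \<open>carrier S\<close>; there both are \<open>undefined\<close> by canonicity.\<close>

lemma restr_obj_inj:
  assumes "canonical_semimodule S M" "canonical_semimodule S N"
    and eq: "restr_obj R \<phi> M = restr_obj R \<phi> N"
  shows "M = N"
proof -
  have "smult M s = smult N s" for s
  proof (cases "s \<in> carrier S")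
    case True
    then obtain a where a: "a \<in> carrier R" "s = \<phi> a" using surj by auto
    have "smult (restr_obj R \<phi> M) a = smult (restr_obj R \<phi> N) a" using eq by simp
    then show ?thesis using a by simp
  next
    case False
    have "smult M \<in> extensional (carrier S)" "smult N \<in> extensional (carrier S)"
      using assms(1,2) by (auto simp: canonical_semimodule_def PiE_def)
    then show ?thesis using False by (simp add: extensional_def)
  qed
  then have "smult M = smult N" by auto
  then show ?thesis using eq by (simp add: restr_obj_def)
qed

lemma full_embedding_restr: "full_embedding (SMod S) (SMod R) (restr_scalars R \<phi>)"
  unfolding full_embedding_def full_functor_def
proof (intro conjI cat_functor_restr ballI impI)
  fix X Y :: "('s, 'n) module" and g :: "('r, 'n) smod_arr"
  assume X: "X \<in> Obj (SMod S)" and Y: "Y \<in> Obj (SMod S)" and g: "g \<in> Arr (SMod R)"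
    and "Dom (SMod R) g = on_obj (restr_scalars R \<phi>) X \<and> Cod (SMod R) g = on_obj (restr_scalars R \<phi>) Y"
  then have "(X, umap g, Y) \<in> Arr (SMod S)" "on_arr (restr_scalars R \<phi>) (X, umap g, Y) = g"
    by (cases g, auto simp: restr_scalars_def restr_hom_surj)+
  then show "\<exists>f\<in>Arr (SMod S). Dom (SMod S) f = X \<and> Cod (SMod S) f = Y \<and> on_arr (restr_scalars R \<phi>) f = g"
    by force
next
  show "inj_on (on_arr (restr_scalars R \<phi>)) (Arr (SMod S))"
    by (rule inj_onI) (auto simp: restr_scalars_def restr_obj_inj)
qed

end


section \<open>Finite sums in a commutative monoid\<close>

text \<open>The operation of \<open>M\<close> is associative and commutative on its carrier only, whereas \<open>fold_mset\<close> needs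
  a step function that commutes on the whole type. Letting the step do nothing whenever a summand or
  the accumulator lies outside the carrier achieves this.\<close>

definition mset_sum :: "('m, 'e) ring_scheme \<Rightarrow> ('p \<Rightarrow> 'm) \<Rightarrow> 'p multiset \<Rightarrow> 'm" where
  "mset_sum M v = fold_mset
    (\<lambda>p y. if v p \<in> carrier M \<and> y \<in> carrier M then v p \<oplus>\<^bsub>M\<^esub> y else y) \<zero>\<^bsub>M\<^esub>"

lemma mset_sum_empty [simp]: "mset_sum M v {#} = \<zero>\<^bsub>M\<^esub>"
  by (simp add: mset_sum_def)

context abelian_monoid
begin

lemma mset_sum_closed: "mset_sum G v X \<in> carrier G"
  and mset_sum_add_mset:
    "v p \<in> carrier G \<Longrightarrow> mset_sum G v (add_mset p X) = v p \<oplus> mset_sum G v X"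
proof -
  let ?f = "\<lambda>p y. if v p \<in> carrier G \<and> y \<in> carrier G then v p \<oplus> y else y"
  interpret comp_fun_commute ?f
    by unfold_locales (auto simp: fun_eq_iff a_ac)
  have step: "mset_sum G v (add_mset p X) = ?f p (mset_sum G v X)" for p X
    unfolding mset_sum_def by (rule fold_mset_add_mset)
  have closed: "mset_sum G v X \<in> carrier G" for X
    by (induction X) (simp_all add: step)
  then show "mset_sum G v X \<in> carrier G" .
  show "mset_sum G v (add_mset p X) = v p \<oplus> mset_sum G v X" if "v p \<in> carrier G"
    using that closed[of X] step[of p X] by simp
qed

lemma mset_sum_union:
  assumes "\<And>p. p \<in># X \<Longrightarrow> v p \<in> carrier G" "\<And>p. p \<in># Y \<Longrightarrow> v p \<in> carrier G"
  shows "mset_sum G v (X + Y) = mset_sum G v X \<oplus> mset_sum G v Y"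
  using assms(1)
  by (induction X) (simp_all add: mset_sum_add_mset mset_sum_closed a_assoc)

end


section \<open>Extension of scalars\<close>

lemma formal_sums_simps [simp]:
  "{#} \<in> formal_sums S M"
  "add_mset p X \<in> formal_sums S M \<longleftrightarrow> p \<in> carrier S \<times> carrier M \<and> X \<in> formal_sums S M"
  "X + Y \<in> formal_sums S M \<longleftrightarrow> X \<in> formal_sums S M \<and> Y \<in> formal_sums S M"
  by (auto simp: formal_sums_def)

lemma formal_sumsD: "\<lbrakk>X \<in> formal_sums S M; (s, x) \<in># X\<rbrakk> \<Longrightarrow> s \<in> carrier S \<and> x \<in> carrier M"
  by (auto simp: formal_sums_def)

abbreviation scale_formal_sum :: "'s ring \<Rightarrow> 's \<Rightarrow> ('s \<times> 'm) multiset \<Rightarrow> ('s \<times> 'm) multiset" where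
  "scale_formal_sum S s \<equiv> image_mset (\<lambda>(t, x). (s \<otimes>\<^bsub>S\<^esub> t, x))"

abbreviation map_formal_sum :: "('m \<Rightarrow> 'n) \<Rightarrow> ('s \<times> 'm) multiset \<Rightarrow> ('s \<times> 'n) multiset" where
  "map_formal_sum f \<equiv> image_mset (\<lambda>(t, x). (t, f x))"

context scalar_change
begin

abbreviation cong :: "('r, 'm) module \<Rightarrow> ('s \<times> 'm) multiset \<Rightarrow> ('s \<times> 'm) multiset \<Rightarrow> bool" where
  "cong \<equiv> tensor_cong R S \<phi>"

abbreviation cls :: "('r, 'm) module \<Rightarrow> ('s \<times> 'm) multiset \<Rightarrow> ('s \<times> 'm) multiset set" where
  "cls \<equiv> tensor_class R S \<phi>"

abbreviation tensor :: "('r, 'm) module \<Rightarrow> ('s, ('s \<times> 'm) multiset set) module" where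
  "tensor \<equiv> ext_obj R S \<phi>"

lemma scale_formal_sum_closed:
  "\<lbrakk>s \<in> carrier S; X \<in> formal_sums S M\<rbrakk> \<Longrightarrow> scale_formal_sum S s X \<in> formal_sums S M"
  by (induction X) auto

lemma map_formal_sum_closed:
  "\<lbrakk>f \<in> semimodule_hom R M N; X \<in> formal_sums S M\<rbrakk> \<Longrightarrow> map_formal_sum f X \<in> formal_sums S N"
  by (induction X) (auto simp: semimodule_hom_closed)

lemma cong_formal_sums:
  assumes "semimodule R M" "cong M X Y"
  shows "X \<in> formal_sums S M" "Y \<in> formal_sums S M"
proof -
  interpret M: semimodule R M by fact
  have "X \<in> formal_sums S M \<and> Y \<in> formal_sums S M"
    using assms(2) by (induction rule: tensor_cong.induct) (auto simp: M.smult_closed)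
  then show "X \<in> formal_sums S M" "Y \<in> formal_sums S M" by auto
qed

text \<open>The action of \<open>s\<close> multiplies the first components from the left and the balancing relation
  multiplies them by \<open>\<phi> a\<close> from the right, so that the two are compatible by associativity alone.\<close>

lemma cong_scale:
  assumes "semimodule R M" "s \<in> carrier S" "cong M X Y"
  shows "cong M (scale_formal_sum S s X) (scale_formal_sum S s Y)"
  using assms(3)
proof (induction rule: tensor_cong.induct)
  case (balanced t a x)
  then show ?case
    using tensor_cong.balanced[of "s \<otimes>\<^bsub>S\<^esub> t" S a R x M \<phi>] assms(2) by (simp add: S.m_assoc)
next
  case (refl X)
  then show ?case using assms(2) by (intro tensor_cong.refl scale_formal_sum_closed)
next
  case (sym X Y)
  from sym.IH show ?case by (rule tensor_cong.sym)
next
  case (trans X Y Z)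
  from trans.IH show ?case by (rule tensor_cong.trans)
next
  case (sum X Y X' Y')
  from tensor_cong.sum[OF sum.IH] show ?case by simp
qed (simp_all add: assms(2) S.r_distr tensor_cong.add_left tensor_cong.add_right
       tensor_cong.zero_left tensor_cong.zero_right)

lemma cong_map:
  assumes "f \<in> semimodule_hom R M N" "cong M X Y"
  shows "cong N (map_formal_sum f X) (map_formal_sum f Y)"
  using assms(2)
proof (induction rule: tensor_cong.induct)
  case (refl X)
  then show ?case by (intro tensor_cong.refl map_formal_sum_closed[OF assms(1)])
next
  case (sym X Y)
  from sym.IH show ?case by (rule tensor_cong.sym)
next
  case (trans X Y Z)
  from trans.IH show ?case by (rule tensor_cong.trans)
next
  case (sum X Y X' Y')
  from tensor_cong.sum[OF sum.IH] show ?case by simp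
qed (simp_all add: semimodule_hom_simps[OF assms(1)] tensor_cong.add_left tensor_cong.add_right
       tensor_cong.zero_left tensor_cong.zero_right tensor_cong.balanced)

lemma cls_eqI: "cong M X Y \<Longrightarrow> cls M X = cls M Y"
  unfolding tensor_class_def by (blast intro: tensor_cong.sym tensor_cong.trans)

text \<open>Operations on the tensor product are unions over the representatives of a class; this lemma
  evaluates such a union at one representative, provided that the value does not depend on it.\<close>

lemma UN_cls:
  assumes "X \<in> formal_sums S M" "\<And>Y. cong M X Y \<Longrightarrow> g Y = g X"
  shows "(\<Union>Y\<in>cls M X. g Y) = g X"
proof (rule UN_constant_eq[of X])
  show "X \<in> cls M X" using tensor_cong.refl[OF assms(1)] by (simp add: tensor_class_def)
qed (simp add: tensor_class_def assms(2))

lemma carrier_tensor: "carrier (tensor M) = cls M ` formal_sums S M"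
  by (simp add: ext_obj_def Let_def)

lemma cls_closed [simp]: "X \<in> formal_sums S M \<Longrightarrow> cls M X \<in> carrier (tensor M)"
  by (simp add: carrier_tensor)

lemma tensorE:
  assumes "A \<in> carrier (tensor M)"
  obtains X where "X \<in> formal_sums S M" "A = cls M X"
  using assms by (auto simp: carrier_tensor)

lemma zero_tensor: "\<zero>\<^bsub>tensor M\<^esub> = cls M {#}"
  by (simp add: ext_obj_def Let_def)

lemma add_cls:
  assumes "X \<in> formal_sums S M" "Y \<in> formal_sums S M"
  shows "cls M X \<oplus>\<^bsub>tensor M\<^esub> cls M Y = cls M (X + Y)"
proof -
  have "cls M X \<oplus>\<^bsub>tensor M\<^esub> cls M Y = (\<Union>X'\<in>cls M X. \<Union>Y'\<in>cls M Y. cls M (X' + Y'))"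
    using assms by (simp add: ext_obj_def Let_def)
  also have "\<dots> = (\<Union>X'\<in>cls M X. cls M (X' + Y))"
  proof (intro SUP_cong HOL.refl UN_cls assms)
    fix X' Y' assume "X' \<in> cls M X" and Y': "cong M Y Y'"
    then have "cong M X X'" by (simp add: tensor_class_def)
    then have "cong M X' X'" using tensor_cong.sym tensor_cong.trans by blast
    then show "cls M (X' + Y') = cls M (X' + Y)"
      using tensor_cong.sym[OF Y'] by (intro cls_eqI tensor_cong.sum)
  qed
  also have "\<dots> = cls M (X + Y)"
  proof (rule UN_cls)
    show "X \<in> formal_sums S M" by fact
    fix X' assume "cong M X X'"
    then show "cls M (X' + Y) = cls M (X + Y)"
      by (rule cls_eqI[OF tensor_cong.sum[OF tensor_cong.sym tensor_cong.refl[OF assms(2)]]])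
  qed
  finally show ?thesis .
qed

lemma smult_cls:
  assumes "semimodule R M" "s \<in> carrier S" "X \<in> formal_sums S M"
  shows "s \<odot>\<^bsub>tensor M\<^esub> cls M X = cls M (scale_formal_sum S s X)"
proof -
  have "s \<odot>\<^bsub>tensor M\<^esub> cls M X = (\<Union>Y\<in>cls M X. cls M (scale_formal_sum S s Y))"
    using assms by (simp add: ext_obj_def Let_def)
  also have "\<dots> = cls M (scale_formal_sum S s X)"
  proof (rule UN_cls)
    show "X \<in> formal_sums S M" by fact
    fix Y assume "cong M X Y"
    then show "cls M (scale_formal_sum S s Y) = cls M (scale_formal_sum S s X)"
      by (rule cls_eqI[OF cong_scale[OF assms(1,2)], symmetric])
  qed
  finally show ?thesis .
qed

lemma ext_map_cls:
  assumes "f \<in> semimodule_hom R M N" "X \<in> formal_sums S M"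
  shows "ext_map R S \<phi> M f N (cls M X) = cls N (map_formal_sum f X)"
proof -
  have "ext_map R S \<phi> M f N (cls M X) = (\<Union>Y\<in>cls M X. cls N (map_formal_sum f Y))"
    using assms by (simp add: ext_map_def)
  also have "\<dots> = cls N (map_formal_sum f X)"
  proof (rule UN_cls)
    show "X \<in> formal_sums S M" by fact
    fix Y assume "cong M X Y"
    then show "cls N (map_formal_sum f Y) = cls N (map_formal_sum f X)"
      by (rule cls_eqI[OF cong_map[OF assms(1)], symmetric])
  qed
  finally show ?thesis .
qed

lemma ext_map_extensional [simp]: "ext_map R S \<phi> M f N \<in> extensional (carrier (tensor M))"
  by (simp add: ext_map_def)

text \<open>The action is defined summand by summand; its additivity in the scalar and the vanishing of
  the action of \<open>\<zero>\<close> hold only up to the congruence, by \<open>add_left\<close> and \<open>zero_left\<close> in each summand.\<close>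

lemma cong_scale_add:
  assumes "s \<in> carrier S" "t \<in> carrier S" "X \<in> formal_sums S M"
  shows "cong M (scale_formal_sum S (s \<oplus>\<^bsub>S\<^esub> t) X) (scale_formal_sum S s X + scale_formal_sum S t X)"
  using assms(3)
proof (induction X)
  case (add p X)
  obtain r x where p: "p = (r, x)" by (cases p)
  have "cong M {#(s \<otimes>\<^bsub>S\<^esub> r \<oplus>\<^bsub>S\<^esub> t \<otimes>\<^bsub>S\<^esub> r, x)#} {#(s \<otimes>\<^bsub>S\<^esub> r, x), (t \<otimes>\<^bsub>S\<^esub> r, x)#}"
    using add.prems assms(1,2) by (intro tensor_cong.add_left) (auto simp: p)
  from tensor_cong.sum[OF this add.IH] show ?case
    using add.prems assms(1,2) by (simp add: p S.l_distr add_mset_commute)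
qed (auto intro: tensor_cong.refl)

lemma cong_scale_zero:
  assumes "X \<in> formal_sums S M"
  shows "cong M (scale_formal_sum S \<zero>\<^bsub>S\<^esub> X) {#}"
  using assms
proof (induction X)
  case (add p X)
  obtain r x where p: "p = (r, x)" by (cases p)
  have "cong M {#(\<zero>\<^bsub>S\<^esub>, x)#} {#}"
    using add.prems by (intro tensor_cong.zero_left) (auto simp: p)
  from tensor_cong.sum[OF this add.IH] show ?case
    using add.prems by (simp add: p)
qed (auto intro: tensor_cong.refl)

lemma semimodule_tensor:
  assumes "semimodule R M"
  shows "semimodule S (tensor M)"
proof (intro semimodule.intro semimodule_axioms.intro semiring_S abelian_monoidI)
  note [simp] = add_cls zero_tensor smult_cls[OF assms] scale_formal_sum_closed
  {
    fix x y z
    assume "x \<in> carrier (tensor M)" "y \<in> carrier (tensor M)" "z \<in> carrier (tensor M)"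
    then show "x \<oplus>\<^bsub>tensor M\<^esub> y \<oplus>\<^bsub>tensor M\<^esub> z = x \<oplus>\<^bsub>tensor M\<^esub> (y \<oplus>\<^bsub>tensor M\<^esub> z)"
      by (auto simp: add.assoc elim!: tensorE)
  next
    fix x y
    assume "x \<in> carrier (tensor M)" "y \<in> carrier (tensor M)"
    then show "x \<oplus>\<^bsub>tensor M\<^esub> y \<in> carrier (tensor M)"
      and "x \<oplus>\<^bsub>tensor M\<^esub> y = y \<oplus>\<^bsub>tensor M\<^esub> x"
      by (auto simp: add.commute elim!: tensorE)
  next
    fix a x y
    assume "a \<in> carrier S" "x \<in> carrier (tensor M)" "y \<in> carrier (tensor M)"
    then show "a \<odot>\<^bsub>tensor M\<^esub> (x \<oplus>\<^bsub>tensor M\<^esub> y) = a \<odot>\<^bsub>tensor M\<^esub> x \<oplus>\<^bsub>tensor M\<^esub> a \<odot>\<^bsub>tensor M\<^esub> y"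
      by (auto elim!: tensorE)
  next
    fix a b x
    assume ab: "a \<in> carrier S" "b \<in> carrier S" and "x \<in> carrier (tensor M)"
    then obtain X where X: "X \<in> formal_sums S M" "x = cls M X" by (auto elim: tensorE)
    have "scale_formal_sum S (a \<otimes>\<^bsub>S\<^esub> b) X = scale_formal_sum S a (scale_formal_sum S b X)"
      using ab X(1) by (auto simp: multiset.map_comp S.m_assoc dest: formal_sumsD intro!: image_mset_cong)
    then show "(a \<otimes>\<^bsub>S\<^esub> b) \<odot>\<^bsub>tensor M\<^esub> x = a \<odot>\<^bsub>tensor M\<^esub> (b \<odot>\<^bsub>tensor M\<^esub> x)"
      using ab X by simp
    show "(a \<oplus>\<^bsub>S\<^esub> b) \<odot>\<^bsub>tensor M\<^esub> x = a \<odot>\<^bsub>tensor M\<^esub> x \<oplus>\<^bsub>tensor M\<^esub> b \<odot>\<^bsub>tensor M\<^esub> x"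
      using ab X cls_eqI[OF cong_scale_add] by simp
  next
    fix x
    assume "x \<in> carrier (tensor M)"
    then obtain X where X: "X \<in> formal_sums S M" "x = cls M X" by (auto elim: tensorE)
    have "scale_formal_sum S \<one>\<^bsub>S\<^esub> X = image_mset (\<lambda>p. p) X"
      using X(1) by (intro image_mset_cong) (auto dest: formal_sumsD)
    then show "\<one>\<^bsub>S\<^esub> \<odot>\<^bsub>tensor M\<^esub> x = x" using X by simp
    show "\<zero>\<^bsub>S\<^esub> \<odot>\<^bsub>tensor M\<^esub> x = \<zero>\<^bsub>tensor M\<^esub>"
      using X cls_eqI[OF cong_scale_zero] by simp
  }
qed (auto simp: zero_tensor add_cls smult_cls[OF assms] scale_formal_sum_closed elim!: tensorE)

lemma canonical_tensor:
  assumes "semimodule R M"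
  shows "canonical_semimodule S (tensor M)"
proof -
  interpret T: semimodule S "tensor M" using assms by (rule semimodule_tensor)
  have "add (tensor M) \<in> extensional (carrier (tensor M))"
    "\<And>A. A \<in> carrier (tensor M) \<Longrightarrow> add (tensor M) A \<in> extensional (carrier (tensor M))"
    "smult (tensor M) \<in> extensional (carrier S)"
    "\<And>s. s \<in> carrier S \<Longrightarrow> smult (tensor M) s \<in> extensional (carrier (tensor M))"
    "monoid.mult (tensor M) = undefined" "one (tensor M) = undefined"
    by (simp_all add: ext_obj_def Let_def)
  then show ?thesis
    unfolding canonical_semimodule_def
    using T.semimodule_axioms T.smult_closed by (auto simp: PiE_def)
qed

lemma ext_map_hom:
  assumes "semimodule R M" "semimodule R N" and f: "f \<in> semimodule_hom R M N"
  shows "ext_map R S \<phi> M f N \<in> semimodule_hom S (tensor M) (tensor N)"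
proof (rule semimodule_homI)
  note [simp] = ext_map_cls[OF f] map_formal_sum_closed[OF f] scale_formal_sum_closed
  show "ext_map R S \<phi> M f N \<in> extensional (carrier (tensor M))"
    by simp
  show "ext_map R S \<phi> M f N \<zero>\<^bsub>tensor M\<^esub> = \<zero>\<^bsub>tensor N\<^esub>"
    by (simp add: zero_tensor)
  fix A assume "A \<in> carrier (tensor M)"
  then obtain X where X: "X \<in> formal_sums S M" "A = cls M X" by (auto elim: tensorE)
  then show "ext_map R S \<phi> M f N A \<in> carrier (tensor N)" by simp
  show "ext_map R S \<phi> M f N (A \<oplus>\<^bsub>tensor M\<^esub> B) =
      ext_map R S \<phi> M f N A \<oplus>\<^bsub>tensor N\<^esub> ext_map R S \<phi> M f N B" if "B \<in> carrier (tensor M)" for B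
    using that X by (auto simp: add_cls elim!: tensorE)
  show "ext_map R S \<phi> M f N (s \<odot>\<^bsub>tensor M\<^esub> A) = s \<odot>\<^bsub>tensor N\<^esub> ext_map R S \<phi> M f N A"
    if "s \<in> carrier S" for s
    using that X assms
    by (auto simp: smult_cls multiset.map_comp intro!: arg_cong[of _ _ "cls N"] image_mset_cong)
qed

lemma cat_functor_ext: "cat_functor (SMod R) (SMod S) (ext_scalars R S \<phi>)"
proof (intro cat_functor.intro category_SMod cat_functor_axioms.intro)
  fix M :: "('r, 'm) module"
  assume "M \<in> Obj (SMod R)"
  then have M: "semimodule R M" by (simp add: canonical_semimoduleD)
  have "map_formal_sum (restrict (\<lambda>x. x) (carrier M)) X = image_mset (\<lambda>p. p) X"
    if "X \<in> formal_sums S M" for X :: "('s \<times> 'm) multiset"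
    using that by (intro image_mset_cong) (auto dest: formal_sumsD)
  then have "ext_map R S \<phi> M (restrict (\<lambda>x. x) (carrier M)) M = restrict (\<lambda>x. x) (carrier (tensor M))"
    by (intro extensionalityI[of _ "carrier (tensor M)"])
      (auto simp: ext_map_cls[OF semimodule_hom_id[OF M]] elim!: tensorE)
  then show "on_arr (ext_scalars R S \<phi>) (Idn (SMod R) M) = Idn (SMod S) (on_obj (ext_scalars R S \<phi>) M)"
    by (simp add: ext_scalars_def)
next
  fix f g :: "('r, 'm) smod_arr"
  assume "f \<in> Arr (SMod R)" "g \<in> Arr (SMod R)" "Cod (SMod R) f = Dom (SMod R) g"
  then obtain L M N f' g' where fg: "f = (L, f', M)" "g = (M, g', N)"
    and f': "f' \<in> semimodule_hom R L M" and g': "g' \<in> semimodule_hom R M N"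
    and L: "semimodule R L" and M: "semimodule R M" and N: "semimodule R N"
    by (cases f, cases g) (auto simp: canonical_semimoduleD)
  have "map_formal_sum (compose (carrier L) g' f') X = map_formal_sum g' (map_formal_sum f' X)"
    if "X \<in> formal_sums S L" for X :: "('s \<times> 'm) multiset"
    using that by (auto simp: multiset.map_comp compose_eq dest: formal_sumsD intro!: image_mset_cong)
  then have "ext_map R S \<phi> L (compose (carrier L) g' f') N =
      compose (carrier (tensor L)) (ext_map R S \<phi> M g' N) (ext_map R S \<phi> L f' M)"
    by (intro extensionalityI[of _ "carrier (tensor L)"])
      (auto simp: compose_eq ext_map_cls[OF semimodule_hom_compose[OF L f' g']] ext_map_cls[OF f']
        ext_map_cls[OF g'] map_formal_sum_closed[OF f'] elim!: tensorE)
  then show "on_arr (ext_scalars R S \<phi>) (Cmp (SMod R) g f) =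
      Cmp (SMod S) (on_arr (ext_scalars R S \<phi>) g) (on_arr (ext_scalars R S \<phi>) f)"
    by (simp add: ext_scalars_def fg)
qed (auto simp: ext_scalars_def canonical_tensor canonical_semimoduleD ext_map_hom)


section \<open>The adjunction\<close>

definition tensor_unit :: "('r, 'm) module \<Rightarrow> 'm \<Rightarrow> ('s \<times> 'm) multiset set" where
  "tensor_unit M = (\<lambda>x\<in>carrier M. cls M {#(\<one>\<^bsub>S\<^esub>, x)#})"

text \<open>The \<open>S\<close>-linear extension \<open>s \<otimes> x \<mapsto> s f(x)\<close>, computed on an arbitrary representative of the class;
  \<open>tensor_lift_cls\<close> shows that the choice does not matter.\<close>

definition tensor_lift ::
    "('r, 'm) module \<Rightarrow> ('s, 'n) module \<Rightarrow> ('m \<Rightarrow> 'n) \<Rightarrow> ('s \<times> 'm) multiset set \<Rightarrow> 'n" where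
  "tensor_lift M N f = (\<lambda>A\<in>carrier (tensor M).
    mset_sum N (\<lambda>(s, x). s \<odot>\<^bsub>N\<^esub> f x) (SOME X. X \<in> A))"

lemma cls_pure:
  assumes "semimodule R M" "s \<in> carrier S" "x \<in> carrier M"
  shows "cls M {#(s, x)#} = s \<odot>\<^bsub>tensor M\<^esub> tensor_unit M x"
  using assms by (simp add: tensor_unit_def smult_cls)

text \<open>Compatibility with scalars is the balancing relation:
  \<open>1 \<otimes> a x = \<phi>(a) \<otimes> x = \<phi>(a) (1 \<otimes> x)\<close>.\<close>

lemma tensor_unit_hom:
  assumes "semimodule R M"
  shows "tensor_unit M \<in> semimodule_hom R M (restr_obj R \<phi> (tensor M))"
proof (rule semimodule_homI)
  interpret M: semimodule R M by fact
  show "tensor_unit M \<in> extensional (carrier M)" by (simp add: tensor_unit_def)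
  show "tensor_unit M \<zero>\<^bsub>M\<^esub> = \<zero>\<^bsub>restr_obj R \<phi> (tensor M)\<^esub>"
    using cls_eqI[OF tensor_cong.zero_right[of "\<one>\<^bsub>S\<^esub>" S R \<phi> M]] by (simp add: tensor_unit_def zero_tensor)
  fix x assume x: "x \<in> carrier M"
  then show "tensor_unit M x \<in> carrier (restr_obj R \<phi> (tensor M))"
    by (simp add: tensor_unit_def)
  show "tensor_unit M (x \<oplus>\<^bsub>M\<^esub> y) =
      tensor_unit M x \<oplus>\<^bsub>restr_obj R \<phi> (tensor M)\<^esub> tensor_unit M y" if "y \<in> carrier M" for y
    using that x cls_eqI[OF tensor_cong.add_right[of "\<one>\<^bsub>S\<^esub>" S x M y R \<phi>]]
    by (simp add: tensor_unit_def add_cls add_mset_commute)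
  show "tensor_unit M (a \<odot>\<^bsub>M\<^esub> x) = a \<odot>\<^bsub>restr_obj R \<phi> (tensor M)\<^esub> tensor_unit M x"
    if "a \<in> carrier R" for a
    using that x assms cls_eqI[OF tensor_cong.balanced[of "\<one>\<^bsub>S\<^esub>" S a R x M \<phi>]]
    by (simp add: tensor_unit_def smult_cls M.smult_closed)
qed

lemma ext_map_unit:
  assumes "f \<in> semimodule_hom R M N" "x \<in> carrier M"
  shows "ext_map R S \<phi> M f N (tensor_unit M x) = tensor_unit N (f x)"
  using assms by (simp add: tensor_unit_def ext_map_cls semimodule_hom_closed)

text \<open>Every class is a finite sum of elements \<open>s (1 \<otimes> x)\<close>. This uniqueness principle replaces computations
  with formal sums wherever two homomorphisms out of a tensor product are compared.\<close>

lemma tensor_hom_eqI: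
  assumes M: "semimodule R M" and g: "g \<in> semimodule_hom S (tensor M) N"
    and h: "h \<in> semimodule_hom S (tensor M) N"
    and eq: "\<And>x. x \<in> carrier M \<Longrightarrow> g (tensor_unit M x) = h (tensor_unit M x)"
  shows "g = h"
proof (rule extensionalityI[of _ "carrier (tensor M)"])
  show "g \<in> extensional (carrier (tensor M))" "h \<in> extensional (carrier (tensor M))"
    using g h by (simp_all add: semimodule_hom_extensional)
  fix A assume "A \<in> carrier (tensor M)"
  then obtain X where X: "X \<in> formal_sums S M" and A: "A = cls M X" by (rule tensorE)
  from X have "g (cls M X) = h (cls M X)"
  proof (induction X)
    case empty
    then show ?case
      using g h by (simp add: zero_tensor[symmetric] semimodule_hom_zero)
  next
    case (add p X)
    obtain s x where p: "p = (s, x)" by (cases p)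
    have sx: "s \<in> carrier S" "x \<in> carrier M" and X: "X \<in> formal_sums S M"
      using add.prems by (auto simp: p)
    have unit: "tensor_unit M x \<in> carrier (tensor M)"
      using sx by (simp add: tensor_unit_def)
    have "cls M (add_mset p X) = cls M {#(s, x)#} \<oplus>\<^bsub>tensor M\<^esub> cls M X"
      using sx X by (simp add: add_cls p)
    then have split: "cls M (add_mset p X) = s \<odot>\<^bsub>tensor M\<^esub> tensor_unit M x \<oplus>\<^bsub>tensor M\<^esub> cls M X"
      using cls_pure[OF M sx] by simp
    have "s \<odot>\<^bsub>tensor M\<^esub> tensor_unit M x \<in> carrier (tensor M)"
      using cls_pure[OF M sx, symmetric] sx by simp
    then show ?case
      unfolding split using sx X unit eq add.IH
      by (simp add: semimodule_hom_add[OF g] semimodule_hom_add[OF h]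
          semimodule_hom_smult[OF g] semimodule_hom_smult[OF h])
  qed
  then show "g A = h A" by (simp add: A)
qed

context
  fixes M :: "('r, 'm) module" and N :: "('s, 'n) module" and f :: "'m \<Rightarrow> 'n"
  assumes M: "semimodule R M" and N: "semimodule S N"
    and f: "f \<in> semimodule_hom R M (restr_obj R \<phi> N)"
begin

interpretation M: semimodule R M by (rule M)
interpretation N: semimodule S N by (rule N)

lemma f_simps:
  "x \<in> carrier M \<Longrightarrow> f x \<in> carrier N"
  "\<lbrakk>x \<in> carrier M; y \<in> carrier M\<rbrakk> \<Longrightarrow> f (x \<oplus>\<^bsub>M\<^esub> y) = f x \<oplus>\<^bsub>N\<^esub> f y"
  "f \<zero>\<^bsub>M\<^esub> = \<zero>\<^bsub>N\<^esub>"
  "\<lbrakk>a \<in> carrier R; x \<in> carrier M\<rbrakk> \<Longrightarrow> f (a \<odot>\<^bsub>M\<^esub> x) = \<phi> a \<odot>\<^bsub>N\<^esub> f x"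
  using semimodule_hom_simps[OF f] by simp_all

abbreviation (input) value_at :: "('s \<times> 'm) \<Rightarrow> 'n" where
  "value_at \<equiv> \<lambda>(s, x). s \<odot>\<^bsub>N\<^esub> f x"

lemma value_at_closed: "\<lbrakk>X \<in> formal_sums S M; p \<in># X\<rbrakk> \<Longrightarrow> value_at p \<in> carrier N"
  by (cases p) (simp add: N.smult_closed f_simps formal_sumsD)

lemma mset_sum_value_at_union:
  "\<lbrakk>X \<in> formal_sums S M; Y \<in> formal_sums S M\<rbrakk>
    \<Longrightarrow> mset_sum N value_at (X + Y) = mset_sum N value_at X \<oplus>\<^bsub>N\<^esub> mset_sum N value_at Y"
  by (rule N.M.mset_sum_union) (blast intro: value_at_closed)+

text \<open>Each generating relation of the tensor product becomes a consequence of the semimodule axioms of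
  \<open>N\<close> and the homomorphism laws of \<open>f\<close> when pairs \<open>(s, x)\<close> are evaluated to \<open>s f(x)\<close>.\<close>

lemma mset_sum_value_at_cong:
  assumes "cong M X Y"
  shows "mset_sum N value_at X = mset_sum N value_at Y"
  using assms
proof (induction rule: tensor_cong.induct)
  case (sum X Y X' Y')
  have "X \<in> formal_sums S M" "Y \<in> formal_sums S M" "X' \<in> formal_sums S M" "Y' \<in> formal_sums S M"
    using cong_formal_sums[OF M] sum.hyps by blast+
  then show ?case by (simp only: mset_sum_value_at_union sum.IH)
qed (simp_all add: N.M.mset_sum_add_mset f_simps N.smult_closed N.smult_assoc N.smult_l_distr
       N.smult_r_distr N.smult_zero_left N.smult_zero_right M.smult_closed)

lemma tensor_lift_cls:
  assumes "X \<in> formal_sums S M"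
  shows "tensor_lift M N f (cls M X) = mset_sum N value_at X"
proof -
  have "X \<in> cls M X" using tensor_cong.refl[OF assms] by (simp add: tensor_class_def)
  then have "(SOME Y. Y \<in> cls M X) \<in> cls M X" by (rule someI)
  then have "cong M X (SOME Y. Y \<in> cls M X)" by (simp add: tensor_class_def)
  from mset_sum_value_at_cong[OF this] show ?thesis
    using assms by (simp add: tensor_lift_def)
qed

lemma tensor_lift_unit: "x \<in> carrier M \<Longrightarrow> tensor_lift M N f (tensor_unit M x) = f x"
  by (simp add: tensor_unit_def tensor_lift_cls N.M.mset_sum_add_mset N.smult_one f_simps)

lemma tensor_lift_hom: "tensor_lift M N f \<in> semimodule_hom S (tensor M) N"
proof (rule semimodule_homI)
  show "tensor_lift M N f \<in> extensional (carrier (tensor M))" by (simp add: tensor_lift_def)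
  show "tensor_lift M N f \<zero>\<^bsub>tensor M\<^esub> = \<zero>\<^bsub>N\<^esub>" by (simp add: zero_tensor tensor_lift_cls)
  fix A assume "A \<in> carrier (tensor M)"
  then obtain X where X: "X \<in> formal_sums S M" and A: "A = cls M X" by (rule tensorE)
  show "tensor_lift M N f A \<in> carrier N"
    using X by (simp add: A tensor_lift_cls N.M.mset_sum_closed)
  show "tensor_lift M N f (A \<oplus>\<^bsub>tensor M\<^esub> B) = tensor_lift M N f A \<oplus>\<^bsub>N\<^esub> tensor_lift M N f B"
    if "B \<in> carrier (tensor M)" for B
    using that X by (auto simp: A add_cls tensor_lift_cls mset_sum_value_at_union elim!: tensorE)
  show "tensor_lift M N f (s \<odot>\<^bsub>tensor M\<^esub> A) = s \<odot>\<^bsub>N\<^esub> tensor_lift M N f A"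
    if s: "s \<in> carrier S" for s
  proof -
    have "mset_sum N value_at (scale_formal_sum S s X) = s \<odot>\<^bsub>N\<^esub> mset_sum N value_at X"
      using X
    proof (induction X)
      case (add p X)
      then show ?case
        using s by (cases p) (simp add: N.M.mset_sum_add_mset N.M.mset_sum_closed N.smult_closed
            N.smult_assoc N.smult_r_distr f_simps)
    qed (simp add: s N.smult_zero_right)
    then show ?thesis
      using s X by (simp add: A smult_cls[OF M] tensor_lift_cls scale_formal_sum_closed)
  qed
qed

end

definition hom_adjunct ::
    "('r, 'm) module \<Rightarrow> (('s \<times> 'm) multiset set \<Rightarrow> 'n) \<Rightarrow> 'm \<Rightarrow> 'n" where
  "hom_adjunct M g = compose (carrier M) g (tensor_unit M)"

lemma hom_adjunct_hom:
  assumes "semimodule R M" "g \<in> semimodule_hom S (tensor M) N"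
  shows "hom_adjunct M g \<in> semimodule_hom R M (restr_obj R \<phi> N)"
  unfolding hom_adjunct_def
  using assms(1) tensor_unit_hom[OF assms(1)] restr_hom[OF assms(2)]
  by (rule semimodule_hom_compose)

text \<open>The inverse is \<open>tensor_lift\<close>: a lift restricts to the given map on the elements \<open>1 \<otimes> x\<close>, and these
  determine a homomorphism.\<close>

lemma bij_betw_hom_adjunct:
  assumes M: "semimodule R M" and N: "semimodule S N"
  shows "bij_betw (hom_adjunct M) (semimodule_hom S (tensor M) N)
    (semimodule_hom R M (restr_obj R \<phi> N))"
proof (rule bij_betwI[where g = "tensor_lift M N"])
  show "hom_adjunct M \<in> semimodule_hom S (tensor M) N \<rightarrow> semimodule_hom R M (restr_obj R \<phi> N)"
    using hom_adjunct_hom[OF M] by blast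
  show "tensor_lift M N \<in> semimodule_hom R M (restr_obj R \<phi> N) \<rightarrow> semimodule_hom S (tensor M) N"
    using tensor_lift_hom[OF M N] by blast
  show "tensor_lift M N (hom_adjunct M g) = g" if "g \<in> semimodule_hom S (tensor M) N" for g
  proof (rule tensor_hom_eqI[OF M])
    note g' = hom_adjunct_hom[OF M that]
    show "tensor_lift M N (hom_adjunct M g) \<in> semimodule_hom S (tensor M) N"
      by (rule tensor_lift_hom[OF M N g'])
    show "tensor_lift M N (hom_adjunct M g) (tensor_unit M x) = g (tensor_unit M x)"
      if "x \<in> carrier M" for x
      using that tensor_lift_unit[OF M N g'] by (simp add: hom_adjunct_def compose_eq)
  qed fact
  show "hom_adjunct M (tensor_lift M N f) = f" if f: "f \<in> semimodule_hom R M (restr_obj R \<phi> N)" for f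
  proof (rule extensionalityI[of _ "carrier M"])
    show "hom_adjunct M (tensor_lift M N f) \<in> extensional (carrier M)" by (simp add: hom_adjunct_def)
    show "f \<in> extensional (carrier M)" using f by (rule semimodule_hom_extensional)
  qed (simp add: hom_adjunct_def compose_eq tensor_lift_unit[OF M N f])
qed

theorem adjunction_ext_restr:
  "smod_adjunction R S (ext_scalars R S \<phi>) (restr_scalars R \<phi>)
    (\<lambda>M N. hom_adjunct M)"
  unfolding smod_adjunction_def
proof (intro conjI cat_functor_ext cat_functor_restr ballI)
  fix M :: "('r, 'm) module" and N :: "('s, 'n) module"
  assume "M \<in> Obj (SMod R)" "N \<in> Obj (SMod S)"
  then show "bij_betw (hom_adjunct M) (semimodule_hom S (on_obj (ext_scalars R S \<phi>) M) N)
      (semimodule_hom R M (on_obj (restr_scalars R \<phi>) N))"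
    by (simp add: bij_betw_hom_adjunct ext_scalars_def restr_scalars_def canonical_semimoduleD)
next
  fix h :: "('r, 'm) smod_arr" and k :: "('s, 'n) smod_arr" and g x
  assume "h \<in> Arr (SMod R)" "k \<in> Arr (SMod S)" and x: "x \<in> carrier (Dom (SMod R) h)"
  then obtain M h' M' N k' N' where hk: "h = (M, h', M')" "k = (N, k', N')"
    and h': "h' \<in> semimodule_hom R M M'"
    by (cases h, cases k) auto
  have "x \<in> carrier M" using x by (simp add: hk)
  moreover have "tensor_unit M x \<in> carrier (tensor M)"
    using \<open>x \<in> carrier M\<close> by (simp add: tensor_unit_def)
  ultimately show "hom_adjunct (Dom (SMod R) h)
      (compose (carrier (on_obj (ext_scalars R S \<phi>) (Dom (SMod R) h))) (umap k)
        (compose (carrier (on_obj (ext_scalars R S \<phi>) (Dom (SMod R) h))) g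
          (umap (on_arr (ext_scalars R S \<phi>) h)))) x =
    umap (on_arr (restr_scalars R \<phi>) k) (hom_adjunct (Cod (SMod R) h) g (umap h x))"
    using h' by (simp add: hk hom_adjunct_def compose_eq ext_scalars_def restr_scalars_def
        ext_map_unit semimodule_hom_closed)
qed

end


section \<open>The counit along a surjection\<close>

context surj_scalar_change
begin

text \<open>The homomorphism \<open>s \<otimes> x \<mapsto> s x\<close>.\<close>

definition counit :: "('s, 'n) module \<Rightarrow> ('s \<times> 'n) multiset set \<Rightarrow> 'n" where
  "counit N = tensor_lift (restr_obj R \<phi> N) N (restrict (\<lambda>x. x) (carrier N))"

lemma
  assumes "semimodule S N"
  shows counit_hom: "counit N \<in> semimodule_hom S (tensor (restr_obj R \<phi> N)) N"
    and counit_unit: "x \<in> carrier N \<Longrightarrow> counit N (tensor_unit (restr_obj R \<phi> N) x) = x"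
proof -
  have R: "semimodule R (restr_obj R \<phi> N)" using assms by (rule semimodule_restr_obj)
  have id: "restrict (\<lambda>x. x) (carrier N) \<in> semimodule_hom R (restr_obj R \<phi> N) (restr_obj R \<phi> N)"
    using semimodule_hom_id[OF R] by simp
  show "counit N \<in> semimodule_hom S (tensor (restr_obj R \<phi> N)) N"
    unfolding counit_def by (rule tensor_lift_hom[OF R assms id])
  show "counit N (tensor_unit (restr_obj R \<phi> N) x) = x" if "x \<in> carrier N"
    unfolding counit_def using tensor_lift_unit[OF R assms id] that by simp
qed

text \<open>Surjectivity enters through \<open>restr_hom_surj\<close>: it makes the unit \<open>x \<mapsto> 1 \<otimes> x\<close> linear over \<open>S\<close>. The
  unit is a right inverse of the counit along any homomorphism of semirings, and once it is
  \<open>S\<close>-linear, \<open>tensor_hom_eqI\<close> shows that it is a left inverse as well.\<close>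

lemma counit_iso:
  assumes N: "semimodule S N"
  shows "counit N \<in> semimodule_iso S (tensor (restr_obj R \<phi> N)) N"
proof -
  let ?N = "restr_obj R \<phi> N"
  let ?T = "tensor ?N"
  have R: "semimodule R ?N" using N by (rule semimodule_restr_obj)
  have T: "semimodule S ?T" using R by (rule semimodule_tensor)
  have unit: "tensor_unit ?N \<in> semimodule_hom S N ?T"
    by (rule restr_hom_surj[OF tensor_unit_hom[OF R]])
  have "compose (carrier ?T) (tensor_unit ?N) (counit N) = restrict (\<lambda>A. A) (carrier ?T)"
  proof (rule tensor_hom_eqI[OF R])
    show "compose (carrier ?T) (tensor_unit ?N) (counit N) \<in> semimodule_hom S ?T ?T"
      by (rule semimodule_hom_compose[OF T counit_hom[OF N] unit])
    show "restrict (\<lambda>A. A) (carrier ?T) \<in> semimodule_hom S ?T ?T"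
      by (rule semimodule_hom_id[OF T])
    show "compose (carrier ?T) (tensor_unit ?N) (counit N) (tensor_unit ?N x) =
        restrict (\<lambda>A. A) (carrier ?T) (tensor_unit ?N x)" if "x \<in> carrier ?N" for x
      using that semimodule_hom_closed[OF unit] by (simp add: compose_eq counit_unit[OF N])
  qed
  then have "tensor_unit ?N (counit N A) = A" if "A \<in> carrier ?T" for A
    using that by (simp add: fun_eq_iff compose_def split: if_splits)
  then show ?thesis
    unfolding semimodule_iso_def
    using counit_hom[OF N] unit counit_unit[OF N] by blast
qed

text \<open>Both sides are \<open>S\<close>-linear in \<open>A\<close>, and at \<open>1 \<otimes> x\<close> both are \<open>h x\<close>.\<close>

lemma counit_natural:
  assumes M: "semimodule S M" and N: "semimodule S N" and h: "h \<in> semimodule_hom S M N"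
    and A: "A \<in> carrier (tensor (restr_obj R \<phi> M))"
  shows "counit N (ext_map R S \<phi> (restr_obj R \<phi> M) h (restr_obj R \<phi> N) A) = h (counit M A)"
proof -
  let ?M = "restr_obj R \<phi> M" and ?N = "restr_obj R \<phi> N"
  let ?Lh = "ext_map R S \<phi> ?M h ?N"
  have R: "semimodule R ?M" "semimodule R ?N" using M N by (simp_all add: semimodule_restr_obj)
  note T = semimodule_tensor[OF R(1)]
  note hR = restr_hom[OF h]
  note Lh = ext_map_hom[OF R hR]
  have "compose (carrier (tensor ?M)) (counit N) ?Lh = compose (carrier (tensor ?M)) h (counit M)"
  proof (rule tensor_hom_eqI[OF R(1)])
    show "compose (carrier (tensor ?M)) (counit N) ?Lh \<in> semimodule_hom S (tensor ?M) N"
      by (rule semimodule_hom_compose[OF T Lh counit_hom[OF N]])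
    show "compose (carrier (tensor ?M)) h (counit M) \<in> semimodule_hom S (tensor ?M) N"
      by (rule semimodule_hom_compose[OF T counit_hom[OF M] h])
    fix x assume x: "x \<in> carrier ?M"
    then have "tensor_unit ?M x \<in> carrier (tensor ?M)"
      using semimodule_hom_closed[OF tensor_unit_hom[OF R(1)]] by simp
    then show "compose (carrier (tensor ?M)) (counit N) ?Lh (tensor_unit ?M x) =
        compose (carrier (tensor ?M)) h (counit M) (tensor_unit ?M x)"
      using x by (simp add: compose_eq ext_map_unit[OF hR] counit_unit[OF N] counit_unit[OF M]
          semimodule_hom_closed[OF h])
  qed
  from fun_cong[OF this, of A] show ?thesis using A by (simp add: compose_eq)
qed

theorem counit_natural_iso:
  "smod_natural_iso (SMod S) S (comp_cfun (ext_scalars R S \<phi>) (restr_scalars R \<phi>)) id_cfun counit"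
  unfolding smod_natural_iso_def
proof (intro conjI ballI)
  show "cat_functor (SMod S) (SMod S) (comp_cfun (ext_scalars R S \<phi>) (restr_scalars R \<phi>))"
    by (rule cat_functor_comp[OF cat_functor_restr cat_functor_ext])
  show "cat_functor (SMod S) (SMod S) id_cfun" by (rule cat_functor_id[OF category_SMod])
qed (auto simp: comp_cfun_def id_cfun_def restr_scalars_def ext_scalars_def canonical_semimoduleD
       counit_iso counit_natural)

end


section \<open>Semimodules over an MV-algebra\<close>

theorem corollary7p12:
  fixes F :: "'a ring" and u :: 'a
  assumes "idempotent_u_semifield F u"
  shows "gamma F u \<in> semiring_hom (pos_cone F) (Gamma F u) \<and>
    gamma F u ` carrier (pos_cone F) = carrier (Gamma F u) \<and>
    full_embedding (SMod (Gamma F u)) (SMod (pos_cone F)) (G F u :: ('a, 'n, 'a, 'n) smod_fun) \<and>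
    (\<exists>\<Phi>. smod_adjunction (pos_cone F) (Gamma F u)
      (G_l F u :: ('a, 'm, 'a, ('a \<times> 'm) multiset set) smod_fun)
      (G F u :: ('a, 'n, 'a, 'n) smod_fun) \<Phi>) \<and>
    (\<exists>\<theta>. smod_natural_iso (SMod (Gamma F u)) (Gamma F u)
      (comp_cfun (G_l F u) (G F u)) (id_cfun :: ('a, 'n, 'a, 'n) smod_fun) \<theta>)"
proof -
  interpret idempotent_u_semifield F u by fact
  interpret surj_scalar_change "pos_cone F" "Gamma F u" "gamma F u"
    by (intro surj_scalar_change.intro scalar_change.intro surj_scalar_change_axioms.intro
        semiring_pos_cone semiring_Gamma gamma_semiring_hom gamma_surj)
  show ?thesis
    unfolding G_def G_l_def
    using gamma_semiring_hom gamma_surj full_embedding_restr adjunction_ext_restr counit_natural_iso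
    by blast
qed

end
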